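(* On the domain of lexicographic preferences, MPS is sd-weakly-strategyproof: for every profile $R=(\succ_j)_{j\le n}$ of lexicographic preferences, every agent $j$, and every lexicographic preference $\succ'_j$ (possibly with a different importance order), letting $R'=(\succ'_j,\succ_{-j})$, if $\mathrm{MPS}(R')_j$ weakly stochastically dominates $\mathrm{MPS}(R)_j$ w.r.t. $\succ_j$, then $\mathrm{MPS}(R')_j=\mathrm{MPS}(R)_j$.
   Context: Setting: $N=\{1,\dots,n\}$ agents; $M=D_1\cup\dots\cup D_p$ items with pairwise disjoint types, $|D_i|=n$, unit supply; bundles $\mathcal D=D_1\times\dots\times D_p$, $x_i$ the type-$i$ component of $x$. An assignment is an $n\times|\mathcal D|$ matrix $(p_{j,x})$ with entries in $[0,1]$, rows summing to $1$, and $\sum_j\sum_{x\ni o}p_{j,x}=1$ for each item $o$. Lexicographic preference: importance order $\rhd_j$ over types and strict orders $\rhd^i_j$ on each $D_i$; $x\succ_j y$ iff there is a type $i$ with $x_i\rhd^i_j y_i$ and $x_{i'}=y_{i'}$ for all $i'\rhd_j i$. $U(\succ,x)=\{y:y\succ x\}\cup\{x\}$; $p$ weakly stochastically dominates $q$ w.r.t. $\succ$ if $\sum_{y\in U(\succ,x)}p_y\ge\sum_{y\in U(\succ,x)}q_y$ for all $x$. MPS: items start with supply $1$; a bundle is available if all its items have positive remaining supply. Continuously in time each agent eats her most preferred available bundle at rate $1$ (each item of it consumed at rate $1$, $p_{j,x}$ growing at rate $1$); exhausted items make all bundles containing them unavailable; the process runs until all items are exhausted; the accumulated matrix is $\mathrm{MPS}(R)$.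 *)

theory Defs
  imports Complex_Main
begin

text \<open>
  Agents are 0..<n, types are 0..<p, and the items of type i are identified with
  0..<n (so item a of type i is the pair (i,a)). A bundle is a list x of length p
  with x!i < n (its type-i component).
  A lexicographic preference is a pair (imp, ord): imp is a strict linear order on
  the types {0..<p}, with (i',i) in imp meaning "type i' is more important than i";
  ord i is a strict linear order on the items {0..<n} of type i, (a,b) in ord i
  meaning "a is preferred to b".\<close>

type_synonym pref = "(nat \<times> nat) set \<times> (nat \<Rightarrow> (nat \<times> nat) set)"

definition bundles :: "nat \<Rightarrow> nat \<Rightarrow> nat list set" where
  "bundles n p = {x. length x = p \<and> (\<forall>i<p. x ! i < n)}"

definition lex_pref :: "nat \<Rightarrow> nat \<Rightarrow> pref \<Rightarrow> bool" where
  "lex_pref n p L \<longleftrightarrow> strict_linear_order_on {0..<p} (fst L) \<and>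
     (\<forall>i<p. strict_linear_order_on {0..<n} (snd L i))"

definition lex_better :: "nat \<Rightarrow> pref \<Rightarrow> nat list \<Rightarrow> nat list \<Rightarrow> bool" where
  "lex_better p L x y \<longleftrightarrow>
     (\<exists>i<p. (x ! i, y ! i) \<in> snd L i \<and> (\<forall>i'<p. (i', i) \<in> fst L \<longrightarrow> x ! i' = y ! i'))"

definition upper_set :: "nat \<Rightarrow> nat \<Rightarrow> pref \<Rightarrow> nat list \<Rightarrow> nat list set" where
  "upper_set n p L x = {y \<in> bundles n p. lex_better p L y x} \<union> {x}"

definition sd_geq :: "nat \<Rightarrow> nat \<Rightarrow> pref \<Rightarrow> (nat list \<Rightarrow> real) \<Rightarrow> (nat list \<Rightarrow> real) \<Rightarrow> bool" where
  "sd_geq n p L P Q \<longleftrightarrow>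
     (\<forall>x\<in>bundles n p. (\<Sum>y\<in>upper_set n p L x. P y) \<ge> (\<Sum>y\<in>upper_set n p L x. Q y))"

text \<open>MPS as the phased eating algorithm. State: remaining supply s i a of item a of type i,
  and accumulated assignment P j x.\<close>

definition available :: "nat \<Rightarrow> (nat \<Rightarrow> nat \<Rightarrow> real) \<Rightarrow> nat list \<Rightarrow> bool" where
  "available p s x \<longleftrightarrow> (\<forall>i<p. s i (x ! i) > 0)"

definition top_bundle :: "nat \<Rightarrow> nat \<Rightarrow> pref \<Rightarrow> (nat \<Rightarrow> nat \<Rightarrow> real) \<Rightarrow> nat list" where
  "top_bundle n p L s = (THE x. x \<in> bundles n p \<and> available p s x \<and>
      (\<forall>y\<in>bundles n p. available p s y \<longrightarrow> y \<noteq> x \<longrightarrow> lex_better p L x y))"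

definition eaters :: "nat \<Rightarrow> nat \<Rightarrow> (nat \<Rightarrow> pref) \<Rightarrow> (nat \<Rightarrow> nat \<Rightarrow> real) \<Rightarrow> nat \<Rightarrow> nat \<Rightarrow> nat" where
  "eaters n p R s i a = card {j. j < n \<and> top_bundle n p (R j) s ! i = a}"

text \<open>one eating phase: everybody eats her top available bundle at rate 1 until
  the first item gets exhausted\<close>
definition mps_step :: "nat \<Rightarrow> nat \<Rightarrow> (nat \<Rightarrow> pref) \<Rightarrow>
    (nat \<Rightarrow> nat \<Rightarrow> real) \<times> (nat \<Rightarrow> nat list \<Rightarrow> real) \<Rightarrow>
    (nat \<Rightarrow> nat \<Rightarrow> real) \<times> (nat \<Rightarrow> nat list \<Rightarrow> real)" where
  "mps_step n p R st = (case st of (s, P) \<Rightarrow>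
     (if \<exists>x\<in>bundles n p. available p s x then
        (let d = Min {s i a / real (eaters n p R s i a) | i a. i < p \<and> a < n \<and> eaters n p R s i a > 0}
         in (\<lambda>i a. s i a - d * real (eaters n p R s i a),
             \<lambda>j x. P j x + (if j < n \<and> x = top_bundle n p (R j) s then d else 0)))
      else (s, P)))"

text \<open>Each phase exhausts at least one of the n*p items, so n*p phases suffice to
  run the process until all items are exhausted.\<close>
definition mps :: "nat \<Rightarrow> nat \<Rightarrow> (nat \<Rightarrow> pref) \<Rightarrow> nat \<Rightarrow> nat list \<Rightarrow> real" where
  "mps n p R = snd ((mps_step n p R ^^ (n * p)) (\<lambda>i a. 1, \<lambda>j x. 0))"

end

theory Submission
  imports Defs
begin

text \<open>
  At any time the available bundles form a product, so an agent with a lexicographic preference eats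
  the best available item of each type: the marginals of MPS are those of independent runs of the
  one-type simultaneous eating rule, and the importance order does not influence them. A one-type run
  is encoded by its exhaustion times. If a deviation changes the share of some item, dominance makes
  the agent gain at the best such item; but until that item is exhausted no item runs out later than
  before, which leaves nothing to gain. Finally, lexicographic dominance of bundle assignments with
  equal marginals forces equality, type by type in order of importance.\<close>

section \<open>Strict linear orders on finite sets\<close>

text \<open>Dominance between bundle assignments yields dominance of marginals at once only for the
  most important type. For a less important type the upper sets give information only within a class
  of bundles agreeing on all more important types, and only after the bundles that already win at a
  more important type are known to balance out. So the one-type result cannot be applied to all
  types beforehand: it enters \<open>lex_sd_geq_imp_eq\<close> as an implication, from dominance of
  a marginal to its equality, invoked at each stage of the induction. The one-type argument does not
  follow the two runs in time. It compares two vectors of exhaustion times through the equations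
  saying that the shares of each item add up to 1. The types can be separated because each has n
  units and n agents eating at rate 1: all types run out together at time 1, so none stops another
  early.\<close>

lemma finite_worst_exists:
  assumes "finite B" "B \<noteq> {}" "strict_linear_order_on A D" "B \<subseteq> A"
  obtains w where "w \<in> B" "\<And>b. b \<in> B \<Longrightarrow> b \<noteq> w \<Longrightarrow> (b, w) \<in> D"
proof -
  have "trans D" "total_on A D"
    using assms(3) by (auto simp: strict_linear_order_on_def)
  have "\<exists>w\<in>B. \<forall>b\<in>B. b \<noteq> w \<longrightarrow> (b, w) \<in> D"
    using assms(1,2,4)
  proof (induction B rule: finite_ne_induct)
    case (singleton x)
    then show ?case by auto
  next
    case (insert x F)
    then obtain w where w: "w \<in> F" "\<forall>b\<in>F. b \<noteq> w \<longrightarrow> (b, w) \<in> D" by auto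
    have "(x, w) \<in> D \<or> (w, x) \<in> D"
      using \<open>total_on A D\<close> insert.prems insert.hyps w(1) by (auto simp: total_on_def)
    then show ?case
    proof
      assume "(x, w) \<in> D"
      then show ?thesis using w by auto
    next
      assume "(w, x) \<in> D"
      then have "\<forall>b\<in>F. (b, x) \<in> D"
        using w \<open>trans D\<close> by (metis transD)
      then show ?thesis by auto
    qed
  qed
  then show ?thesis using that by blast
qed

lemma strict_linear_order_on_converse:
  "strict_linear_order_on A D \<Longrightarrow> strict_linear_order_on A (D\<inverse>)"
  by (simp add: strict_linear_order_on_def)

lemma finite_best_exists:
  assumes "finite B" "B \<noteq> {}" "strict_linear_order_on A D" "B \<subseteq> A"
  obtains w where "w \<in> B" "\<And>b. b \<in> B \<Longrightarrow> b \<noteq> w \<Longrightarrow> (w, b) \<in> D"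
  using finite_worst_exists[OF assms(1,2) strict_linear_order_on_converse[OF assms(3)] assms(4)]
  by (metis converse_iff)

lemma strict_linear_order_on_asym:
  "strict_linear_order_on A D \<Longrightarrow> (a, b) \<in> D \<Longrightarrow> (b, a) \<notin> D"
  by (meson irrefl_def strict_linear_order_on_def transD)

lemma strict_linear_order_on_subset:
  "strict_linear_order_on A D \<Longrightarrow> B \<subseteq> A \<Longrightarrow> strict_linear_order_on B D"
  by (auto simp: strict_linear_order_on_def total_on_def)

section \<open>Shares determined by exhaustion times\<close>

text \<open>An agent with order \<open>D\<close> starts to eat \<open>a\<close> when all items better than \<open>a\<close> are exhausted, so she
  gets nothing of \<open>a\<close> if that happens after \<open>\<tau> a\<close>.\<close>

definition start_time :: "'a set \<Rightarrow> ('a \<times> 'a) set \<Rightarrow> ('a \<Rightarrow> real) \<Rightarrow> 'a \<Rightarrow> real" where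
  "start_time A D \<tau> a = Max (insert 0 (\<tau> ` {b \<in> A. (b, a) \<in> D}))"

definition share :: "'a set \<Rightarrow> ('a \<times> 'a) set \<Rightarrow> ('a \<Rightarrow> real) \<Rightarrow> 'a \<Rightarrow> real" where
  "share A D \<tau> a = max 0 (\<tau> a - start_time A D \<tau> a)"

lemma share_nonneg: "0 \<le> share A D \<tau> a"
  by (simp add: share_def)

lemma start_time_nonneg: "finite A \<Longrightarrow> 0 \<le> start_time A D \<tau> a"
  by (simp add: start_time_def)

lemma le_start_time: "finite A \<Longrightarrow> b \<in> A \<Longrightarrow> (b, a) \<in> D \<Longrightarrow> \<tau> b \<le> start_time A D \<tau> a"
  by (auto simp: start_time_def intro!: Max_ge)

lemma start_time_le:
  "finite A \<Longrightarrow> 0 \<le> u \<Longrightarrow> (\<And>b. b \<in> A \<Longrightarrow> (b, a) \<in> D \<Longrightarrow> \<tau> b \<le> u) \<Longrightarrow> start_time A D \<tau> a \<le> u"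
  by (auto simp: start_time_def)

lemma share_antimono_set:
  assumes "finite A" "B \<subseteq> A"
  shows "share A D \<tau> b \<le> share B D \<tau> b"
proof -
  have "start_time B D \<tau> b \<le> start_time A D \<tau> b"
    unfolding start_time_def using assms by (intro Max_mono) auto
  then show ?thesis by (simp add: share_def)
qed

text \<open>An agent restricted to \<open>B\<close> eats without pause until the last item of
  \<open>B\<close> is gone. The induction removes the worst item, which contributes just the time it
  outlasts all the others.\<close>

lemma sum_share_eq_Max:
  assumes "finite B" "strict_linear_order_on B D"
  shows "(\<Sum>b\<in>B. share B D \<tau> b) = Max (insert 0 (\<tau> ` B))"
  using assms
proof (induction B rule: finite_psubset_induct)
  case (psubset B)
  show ?case
  proof (cases "B = {}")
    case False
    obtain w where w: "w \<in> B" "\<And>b. b \<in> B \<Longrightarrow> b \<noteq> w \<Longrightarrow> (b, w) \<in> D"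
      using finite_worst_exists[OF psubset.hyps(1) False psubset.prems] by blast
    let ?B = "B - {w}"
    have irr: "(w, w) \<notin> D" using psubset.prems by (auto simp: strict_linear_order_on_def irrefl_def)
    have better: "{b \<in> B. (b, w) \<in> D} = ?B" using w irr by auto
    \<comment> \<open>The worst item is better than nothing, so its removal leaves the start times
      of the others unchanged.\<close>
    have "{c \<in> B. (c, b) \<in> D} = {c \<in> ?B. (c, b) \<in> D}" if "b \<in> ?B" for b
      using w(2)[of b] that strict_linear_order_on_asym[OF psubset.prems] by auto
    then have "(\<Sum>b\<in>?B. share B D \<tau> b) = (\<Sum>b\<in>?B. share ?B D \<tau> b)"
      by (intro sum.cong) (simp_all add: share_def start_time_def)
    also have "\<dots> = Max (insert 0 (\<tau> ` ?B))"
      using w(1) by (intro psubset.IH strict_linear_order_on_subset[OF psubset.prems]) auto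
    finally have "(\<Sum>b\<in>B. share B D \<tau> b) = Max (insert 0 (\<tau> ` ?B)) + share B D \<tau> w"
      using w(1) psubset.hyps(1) by (simp add: sum.remove)
    also have "\<dots> = max (\<tau> w) (Max (insert 0 (\<tau> ` ?B)))"
      by (simp add: share_def start_time_def better max_def)
    also have "\<dots> = Max (insert (\<tau> w) (insert 0 (\<tau> ` ?B)))"
      using psubset.hyps(1) by (subst (2) Max_insert) auto
    also have "insert (\<tau> w) (insert 0 (\<tau> ` ?B)) = insert 0 (\<tau> ` B)"
      using w(1) by auto
    finally show ?thesis .
  qed simp
qed

text \<open>Discarding the items outside \<open>B\<close> only lets the agent start earlier on those
  in \<open>B\<close>. The set \<open>B\<close> need not be closed under better items: it will be an
  upper set of the true order, while the shares follow the reported one.\<close>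

lemma sum_share_le:
  assumes "finite A" "strict_linear_order_on A D" "B \<subseteq> A" "0 \<le> u" "\<And>b. b \<in> B \<Longrightarrow> \<tau> b \<le> u"
  shows "(\<Sum>b\<in>B. share A D \<tau> b) \<le> u"
proof -
  have fin: "finite B" using assms finite_subset by blast
  have "(\<Sum>b\<in>B. share A D \<tau> b) \<le> (\<Sum>b\<in>B. share B D \<tau> b)"
    using assms by (intro sum_mono share_antimono_set)
  also have "\<dots> = Max (insert 0 (\<tau> ` B))"
    using assms fin strict_linear_order_on_subset by (intro sum_share_eq_Max) auto
  also have "\<dots> \<le> u"
    using assms fin by auto
  finally show ?thesis .
qed

lemma sum_share_better:
  assumes "finite A" "strict_linear_order_on A D"
  shows "(\<Sum>b | b \<in> A \<and> (b, a) \<in> D. share A D \<tau> b) = start_time A D \<tau> a"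
proof -
  let ?B = "{b \<in> A. (b, a) \<in> D}"
  have "{c \<in> A. (c, b) \<in> D} = {c \<in> ?B. (c, b) \<in> D}" if "b \<in> ?B" for b
    using that assms(2) by (auto simp: strict_linear_order_on_def dest: transD)
  then have "(\<Sum>b\<in>?B. share A D \<tau> b) = (\<Sum>b\<in>?B. share ?B D \<tau> b)"
    by (intro sum.cong) (simp_all add: share_def start_time_def)
  also have "\<dots> = Max (insert 0 (\<tau> ` ?B))"
    using assms by (intro sum_share_eq_Max strict_linear_order_on_subset[OF assms(2)]) auto
  finally show ?thesis by (simp add: start_time_def)
qed

text \<open>As \<open>b\<close> is eaten at all, every better item is exhausted strictly before
  \<tau> b and hence lasts no longer under \<tau>'. So eating of \<open>b\<close> starts no later,
  and its extra lifetime is pure gain.\<close>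

lemma share_mono_time:
  assumes "finite A" "\<And>c. c \<in> A \<Longrightarrow> \<tau> c < \<tau> b \<Longrightarrow> \<tau>' c \<le> \<tau> c" "\<tau> b \<le> \<tau>' b" "0 < share A D \<tau> b"
  shows "share A D \<tau> b + (\<tau>' b - \<tau> b) \<le> share A D \<tau>' b"
proof -
  have *: "start_time A D \<tau> b < \<tau> b" using assms(4) by (simp add: share_def)
  have "start_time A D \<tau>' b \<le> start_time A D \<tau> b"
  proof (intro start_time_le)
    fix c assume c: "c \<in> A" "(c, b) \<in> D"
    then have "\<tau> c \<le> start_time A D \<tau> b" using assms(1) by (intro le_start_time)
    with * c assms(2)[of c] show "\<tau>' c \<le> start_time A D \<tau> b" by simp
  qed (use assms start_time_nonneg in auto)
  then show ?thesis using * assms(3) by (simp add: share_def)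
qed

section \<open>Weak strategyproofness for a single type\<close>

text \<open>Two one-type runs differing in the preference of \<open>j\<close>, known only through
  their exhaustion times and the fact that each item is fully eaten.\<close>

locale ps_deviation =
  fixes A :: "'a set" and N :: "'k set" and j :: 'k
    and D D' :: "'k \<Rightarrow> ('a \<times> 'a) set" and \<tau> \<tau>' :: "'a \<Rightarrow> real"
  assumes finite_A: "finite A" and finite_N: "finite N" and j: "j \<in> N"
    and order: "strict_linear_order_on A (D j)" "strict_linear_order_on A (D' j)"
    and others: "\<And>k. k \<in> N \<Longrightarrow> k \<noteq> j \<Longrightarrow> D' k = D k"
    and \<tau>_nonneg: "\<And>a. a \<in> A \<Longrightarrow> 0 \<le> \<tau> a" and \<tau>'_le: "\<And>a. a \<in> A \<Longrightarrow> \<tau>' a \<le> 1"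
    and column: "\<And>a. a \<in> A \<Longrightarrow> (\<Sum>k\<in>N. share A (D k) \<tau> a) = 1"
    and column': "\<And>a. a \<in> A \<Longrightarrow> (\<Sum>k\<in>N. share A (D' k) \<tau>' a) = 1"
begin

lemma others_share_mono:
  assumes "k \<in> N" "k \<noteq> j" "\<And>c. c \<in> A \<Longrightarrow> \<tau> c < \<tau> b \<Longrightarrow> \<tau>' c \<le> \<tau> c" "\<tau> b \<le> \<tau>' b"
  shows "share A (D k) \<tau> b \<le> share A (D' k) \<tau>' b"
proof (cases "0 < share A (D k) \<tau> b")
  case True
  from share_mono_time[OF finite_A assms(3,4) True] assms show ?thesis by (simp add: others)
next
  case False
  then show ?thesis using share_nonneg[of A "D' k" \<tau>' b] by linarith
qed

text \<open>Among the items violating the claim, one with the smallest \<open>\<tau>\<close> would be eaten at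
  least as much by everybody after the deviation, and strictly more by each agent other than the
  deviator who eats it at all.\<close>

lemma exhaustion_earlier:
  assumes B: "B \<subseteq> A" "\<And>b c. b \<in> B \<Longrightarrow> c \<in> A \<Longrightarrow> \<tau> c < \<tau> b \<Longrightarrow> c \<in> B"
    and dev: "\<And>b. b \<in> B \<Longrightarrow> share A (D j) \<tau> b \<le> share A (D' j) \<tau>' b"
    and "b \<in> B"
  shows "\<tau>' b \<le> \<tau> b"
proof (rule ccontr)
  assume "\<not> \<tau>' b \<le> \<tau> b"
  define Bad where "Bad = {b \<in> B. \<not> \<tau>' b \<le> \<tau> b}"
  have "finite Bad" "Bad \<noteq> {}"
    using B(1) finite_A \<open>b \<in> B\<close> \<open>\<not> \<tau>' b \<le> \<tau> b\<close> finite_subset[of B A] by (auto simp: Bad_def)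
  from ex_min_if_finite[of "\<tau> ` Bad"] this
  obtain b where b: "b \<in> Bad" "\<And>c. c \<in> Bad \<Longrightarrow> \<not> \<tau> c < \<tau> b" by auto
  then have bA: "b \<in> A" "b \<in> B" and less: "\<tau> b < \<tau>' b" using B(1) by (auto simp: Bad_def)
  \<comment> \<open>Closure of \<open>B\<close> under smaller \<tau> puts such an item in
    \<open>B\<close>, and minimality of \<open>b\<close> keeps it out of \<open>Bad\<close>.\<close>
  have earlier: "\<tau>' c \<le> \<tau> c" if "c \<in> A" "\<tau> c < \<tau> b" for c
    using that b(2)[of c] B(2)[of b c] bA by (auto simp: Bad_def)
  have mono: "share A (D k) \<tau> b \<le> share A (D' k) \<tau>' b" if "k \<in> N" for k
    using that others_share_mono[OF that _ earlier] dev[of b] less bA by (cases "k = j") auto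
  have eq: "share A (D k) \<tau> b = share A (D' k) \<tau>' b" if "k \<in> N" for k
  proof (rule ccontr)
    assume "share A (D k) \<tau> b \<noteq> share A (D' k) \<tau>' b"
    then have "share A (D k) \<tau> b < share A (D' k) \<tau>' b" using mono[OF that] by simp
    then have "(\<Sum>k\<in>N. share A (D k) \<tau> b) < (\<Sum>k\<in>N. share A (D' k) \<tau>' b)"
      using that finite_N mono by (intro sum_strict_mono_ex1) auto
    then show False using column column' bA by simp
  qed
  have "share A (D k) \<tau> b = 0" if "k \<in> N" "k \<noteq> j" for k
  proof (rule ccontr)
    assume "share A (D k) \<tau> b \<noteq> 0"
    then have "0 < share A (D k) \<tau> b" using share_nonneg[of A "D k" \<tau> b] by linarith
    from share_mono_time[OF finite_A earlier _ this] eq[OF that(1)] less that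
    show False by (simp add: others)
  qed
  then have "(\<Sum>k\<in>N. share A (D k) \<tau> b) = share A (D j) \<tau> b"
    using finite_N j by (subst sum.remove[of _ j]) auto
  \<comment> \<open>The deviator would eat all of \<open>b\<close> alone, at rate 1; so
    \<open>b\<close> would last until time 1 or later, leaving no room for a larger \<tau>'
    b.\<close>
  then have "share A (D j) \<tau> b = 1" using column bA by simp
  then have "1 \<le> \<tau> b"
    using start_time_nonneg[OF finite_A, of "D j" \<tau> b] by (auto simp: share_def max_def split: if_splits)
  then show False using less \<tau>'_le bA by fastforce
qed

text \<open>The best item whose share changes has, by dominance, a strictly larger share after the
  deviation; but \<open>exhaustion_earlier\<close> shows that this is impossible.\<close>

theorem ps_weak_strategyproof:
  assumes dom: "\<And>a. a \<in> A \<Longrightarrow>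
      (\<Sum>b | b \<in> A \<and> (b = a \<or> (b, a) \<in> D j). share A (D j) \<tau> b) \<le>
      (\<Sum>b | b \<in> A \<and> (b = a \<or> (b, a) \<in> D j). share A (D' j) \<tau>' b)"
    and "a \<in> A"
  shows "share A (D' j) \<tau>' a = share A (D j) \<tau> a"
proof (rule ccontr)
  assume neq: "share A (D' j) \<tau>' a \<noteq> share A (D j) \<tau> a"
  let ?p = "share A (D j) \<tau>" and ?q = "share A (D' j) \<tau>'"
  define Bad where "Bad = {a \<in> A. ?q a \<noteq> ?p a}"
  have "finite Bad" "Bad \<noteq> {}" "Bad \<subseteq> A" using finite_A neq \<open>a \<in> A\<close> by (auto simp: Bad_def)
  then obtain a where a: "a \<in> Bad" "\<And>b. b \<in> Bad \<Longrightarrow> b \<noteq> a \<Longrightarrow> (a, b) \<in> D j"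
    using finite_best_exists order(1) by metis
  then have aA: "a \<in> A" and neq: "?q a \<noteq> ?p a" by (auto simp: Bad_def)
  define W where "W = {b \<in> A. (b, a) \<in> D j}"
  define m where "m = start_time A (D j) \<tau> a"
  have irr: "(b, b) \<notin> D j" for b using order(1) by (auto simp: strict_linear_order_on_def irrefl_def)
  have W: "finite W" "a \<notin> W" "W \<subseteq> A" using finite_A irr by (auto simp: W_def)
  have eqW: "?q b = ?p b" if "b \<in> W" for b
    using that a(2)[of b] strict_linear_order_on_asym[OF order(1)] irr by (auto simp: W_def Bad_def)
  have sumW: "(\<Sum>b\<in>W. ?p b) = m"
    using sum_share_better[OF finite_A order(1)] by (simp add: W_def m_def)
  have "{b \<in> A. b = a \<or> (b, a) \<in> D j} = insert a W" using aA by (auto simp: W_def)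
  then have "?p a + (\<Sum>b\<in>W. ?p b) \<le> ?q a + (\<Sum>b\<in>W. ?q b)" using dom[OF aA] W by simp
  moreover have sumq: "(\<Sum>b\<in>W. ?q b) = m" using sumW eqW by simp
  ultimately have less: "?p a < ?q a" using neq sumW by simp
  have sumqa: "m + ?q a = (\<Sum>b\<in>insert a W. ?q b)" using W sumq by simp
  have m0: "0 \<le> m" by (simp add: m_def start_time_nonneg finite_A)
  have W_le: "\<tau> b \<le> m" if "b \<in> W" for b
    using that finite_A by (auto simp: W_def m_def intro: le_start_time)
  have worse: "(a, b) \<in> D j" if "b \<in> A" "b \<notin> W" "b \<noteq> a" for b
    using that order(1) aA by (auto simp: W_def strict_linear_order_on_def total_on_def)
  \<comment> \<open>An item outside \<open>W\<close> other than \<open>a\<close> is worse than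
    \<open>a\<close> and all of \<open>W\<close>, so it is reached only at time
    \<open>max m (\<tau> a)\<close> or later; if it is gone by then, its truthful share is
    0.\<close>
  have dev: "?p b \<le> ?q b" if b: "b \<in> A" "\<tau> b \<le> max m (\<tau> a)" "b \<noteq> a" for b
  proof (cases "b \<in> W")
    case False
    note ab = worse[OF b(1) False b(3)]
    have "(c, b) \<in> D j" if "c \<in> W" for c
      using that ab order(1) by (auto simp: W_def strict_linear_order_on_def dest: transD)
    then have "m \<le> start_time A (D j) \<tau> b"
      unfolding m_def using finite_A start_time_nonneg[OF finite_A]
      by (intro start_time_le) (auto simp: W_def intro: le_start_time)
    moreover have "\<tau> a \<le> start_time A (D j) \<tau> b"
      using ab aA finite_A by (intro le_start_time)
    ultimately have "?p b = 0" using b(2) by (simp add: share_def)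
    then show ?thesis by (simp add: share_nonneg)
  qed (simp add: eqW)
  show False
  \<comment> \<open>Truthfully, the agent is ready for \<open>a\<close> at time \<open>m\<close>:
    either it is already gone, or she eats it until \<tau> a.\<close>
  proof (cases "\<tau> a \<le> m")
    case True
    have earlier: "\<tau>' b \<le> \<tau> b" if "b \<in> A" "\<tau> b \<le> m" for b
    proof (rule exhaustion_earlier[of "{b \<in> A. \<tau> b \<le> m}"])
      fix c assume c: "c \<in> {b \<in> A. \<tau> b \<le> m}"
      show "?p c \<le> ?q c" using dev[of c] c True less by (cases "c = a") auto
    qed (use that in auto)
    \<comment> \<open>By time \<open>m\<close> all of \<open>insert a W\<close> is gone after the
      deviation, while the shares in \<open>W\<close> alone already take up
      \<open>m\<close>.\<close>
    have "(\<Sum>b\<in>insert a W. ?q b) \<le> m"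
    proof (rule sum_share_le[OF finite_A order(2) _ m0])
      fix b assume "b \<in> insert a W"
      then have "b \<in> A" "\<tau> b \<le> m" using W aA True W_le by auto
      then show "\<tau>' b \<le> m" using earlier by force
    qed (use W aA in auto)
    then have "?q a \<le> 0" using sumqa by simp
    then show False using less share_nonneg[of A "D j" \<tau> a] by simp
  next
    case False
    have earlier: "\<tau>' b \<le> \<tau> b" if "b \<in> A" "\<tau> b < \<tau> a" for b
    proof (rule exhaustion_earlier[of "{b \<in> A. \<tau> b < \<tau> a}"])
      fix c assume c: "c \<in> {b \<in> A. \<tau> b < \<tau> a}"
      show "?p c \<le> ?q c" using dev[of c] c by (cases "c = a") auto
    qed (use that in auto)
    have pa: "?p a = \<tau> a - m" using False by (simp add: share_def m_def)
    \<comment> \<open>Otherwise \<open>insert a W\<close> is gone by time \<tau> a after the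
      deviation, so the share of \<open>a\<close> is at most \<open>\<tau> a - m\<close>, the
      truthful one.\<close>
    have later: "\<tau> a \<le> \<tau>' a"
    proof (rule ccontr)
      assume "\<not> \<tau> a \<le> \<tau>' a"
      have "(\<Sum>b\<in>insert a W. ?q b) \<le> \<tau> a"
      proof (rule sum_share_le[OF finite_A order(2)])
        fix b assume b: "b \<in> insert a W"
        show "\<tau>' b \<le> \<tau> a"
          using b \<open>\<not> \<tau> a \<le> \<tau>' a\<close> W_le[of b] earlier[of b] False W by force
      qed (use W aA False m0 in auto)
      then show False using sumqa pa less by simp
    qed
    \<comment> \<open>Nobody eats less of \<open>a\<close> than before and the deviator eats more,
      which exceeds the unit supply.\<close>
    have "(\<Sum>k\<in>N. share A (D k) \<tau> a) < (\<Sum>k\<in>N. share A (D' k) \<tau>' a)"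
    proof (rule sum_strict_mono_ex1[OF finite_N])
      show "\<forall>k\<in>N. share A (D k) \<tau> a \<le> share A (D' k) \<tau>' a"
        using others_share_mono[OF _ _ earlier later] less by (metis less_imp_le)
    qed (use j less in auto)
    then show False using column column' aA by simp
  qed
qed

end

section \<open>Bundles\<close>

definition marginal :: "nat \<Rightarrow> nat \<Rightarrow> (nat list \<Rightarrow> real) \<Rightarrow> nat \<Rightarrow> nat \<Rightarrow> real" where
  "marginal n p P i a = (\<Sum>x | x \<in> bundles n p \<and> x ! i = a. P x)"

lemma finite_bundles: "finite (bundles n p)"
proof -
  have "bundles n p = {x. set x \<subseteq> {0..<n} \<and> length x = p}"
    by (fastforce simp: bundles_def in_set_conv_nth)
  then show ?thesis using finite_lists_length_eq[of "{0..<n}" p] by simp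
qed

lemma sum_marginal:
  assumes "i < p" "B \<subseteq> {0..<n}"
  shows "(\<Sum>a\<in>B. marginal n p P i a) = (\<Sum>x | x \<in> bundles n p \<and> x ! i \<in> B. P x)"
proof -
  have "(\<Sum>x | x \<in> bundles n p \<and> x ! i \<in> B. P x)
      = (\<Sum>a\<in>B. \<Sum>x | x \<in> {x \<in> bundles n p. x ! i \<in> B} \<and> x ! i = a. P x)"
    using assms finite_bundles finite_subset[of B]
    by (intro sum.group[symmetric]) auto
  also have "\<dots> = (\<Sum>a\<in>B. marginal n p P i a)"
    unfolding marginal_def by (intro sum.cong refl) auto
  finally show ?thesis by simp
qed

lemma sum_marginal_all:
  assumes "i < p"
  shows "(\<Sum>a<n. marginal n p P i a) = (\<Sum>x\<in>bundles n p. P x)"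
proof -
  have "{x \<in> bundles n p. x ! i \<in> {..<n}} = bundles n p" using assms by (auto simp: bundles_def)
  then show ?thesis using sum_marginal[OF assms, of "{..<n}" n P] by (simp add: atLeast0LessThan)
qed

lemma lex_prefD:
  assumes "lex_pref n p L"
  shows "strict_linear_order_on {0..<p} (fst L)"
    and "i < p \<Longrightarrow> strict_linear_order_on {0..<n} (snd L i)"
  using assms by (auto simp: lex_pref_def)

lemma first_difference:
  assumes "lex_pref n p L" "x \<in> bundles n p" "y \<in> bundles n p" "x \<noteq> y"
  obtains i where "i < p" "x ! i \<noteq> y ! i" "\<And>i'. i' < p \<Longrightarrow> (i', i) \<in> fst L \<Longrightarrow> x ! i' = y ! i'"
proof -
  let ?B = "{i. i < p \<and> x ! i \<noteq> y ! i}"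
  have ne: "?B \<noteq> {}" using assms by (auto simp: bundles_def intro: nth_equalityI)
  obtain i where i: "i \<in> ?B" "\<And>b. b \<in> ?B \<Longrightarrow> b \<noteq> i \<Longrightarrow> (i, b) \<in> fst L"
    by (rule finite_best_exists[OF _ ne lex_prefD(1)[OF assms(1)]]) auto
  have "x ! i' = y ! i'" if "i' < p" "(i', i) \<in> fst L" for i'
    using that i(2)[of i'] strict_linear_order_on_asym[OF lex_prefD(1)[OF assms(1)]] by blast
  then show ?thesis using that i(1) by blast
qed

text \<open>The available bundles form a product, so the top one is the componentwise top; the
  importance order plays no role.\<close>

lemma top_bundle_componentwise:
  assumes L: "lex_pref n p L" and ex: "\<exists>x\<in>bundles n p. available p s x"
  defines "x \<equiv> top_bundle n p L s"
  shows "x \<in> bundles n p"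
    and "\<And>i. i < p \<Longrightarrow> 0 < s i (x ! i)"
    and "\<And>i b. i < p \<Longrightarrow> b < n \<Longrightarrow> 0 < s i b \<Longrightarrow> b \<noteq> x ! i \<Longrightarrow> (x ! i, b) \<in> snd L i"
proof -
  have "\<forall>i. \<exists>c. i < p \<longrightarrow> c < n \<and> 0 < s i c \<and> (\<forall>b<n. 0 < s i b \<longrightarrow> b \<noteq> c \<longrightarrow> (c, b) \<in> snd L i)"
  proof
    fix i
    show "\<exists>c. i < p \<longrightarrow> c < n \<and> 0 < s i c \<and> (\<forall>b<n. 0 < s i b \<longrightarrow> b \<noteq> c \<longrightarrow> (c, b) \<in> snd L i)"
    proof (cases "i < p")
      case True
      let ?B = "{b. b < n \<and> 0 < s i b}"
      have ne: "?B \<noteq> {}" using ex True by (auto simp: bundles_def available_def)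
      obtain c where "c \<in> ?B" "\<And>b. b \<in> ?B \<Longrightarrow> b \<noteq> c \<Longrightarrow> (c, b) \<in> snd L i"
        by (rule finite_best_exists[OF _ ne lex_prefD(2)[OF L True]]) auto
      then show ?thesis by blast
    qed simp
  qed
  then obtain c where c: "\<And>i. i < p \<Longrightarrow> c i < n \<and> 0 < s i (c i)"
      "\<And>i b. i < p \<Longrightarrow> b < n \<Longrightarrow> 0 < s i b \<Longrightarrow> b \<noteq> c i \<Longrightarrow> (c i, b) \<in> snd L i"
    by (metis (no_types, lifting) choice)
  define z where "z = map c [0..<p]"
  have z: "z \<in> bundles n p" "available p s z" "\<And>i. i < p \<Longrightarrow> z ! i = c i"
    using c by (auto simp: z_def bundles_def available_def)
  have best: "lex_better p L z y" if y: "y \<in> bundles n p" "available p s y" "y \<noteq> z" for y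
  proof -
    obtain i where i: "i < p" "z ! i \<noteq> y ! i" "\<And>i'. i' < p \<Longrightarrow> (i', i) \<in> fst L \<Longrightarrow> z ! i' = y ! i'"
      using first_difference[OF L z(1) y(1)] y(3) by metis
    have "(z ! i, y ! i) \<in> snd L i"
      using c(2)[of i "y ! i"] i(1,2) y z(3)[of i] by (auto simp: bundles_def available_def)
    then show ?thesis using i unfolding lex_better_def by blast
  qed
  have "x = z"
    unfolding x_def top_bundle_def
  proof (rule the_equality)
    show "z \<in> bundles n p \<and> available p s z \<and>
        (\<forall>y\<in>bundles n p. available p s y \<longrightarrow> y \<noteq> z \<longrightarrow> lex_better p L z y)"
      using z best by blast
    fix y assume y: "y \<in> bundles n p \<and> available p s y \<and>
        (\<forall>y'\<in>bundles n p. available p s y' \<longrightarrow> y' \<noteq> y \<longrightarrow> lex_better p L y y')"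
    show "y = z"
    proof (rule ccontr)
      \<comment> \<open>A rival top bundle would have to beat \<open>z\<close> at some type, where
        \<open>z\<close> already holds the best remaining item.\<close>
      assume "y \<noteq> z"
      then have "lex_better p L y z" using y z by blast
      then obtain i where i: "i < p" "(y ! i, c i) \<in> snd L i" by (auto simp: lex_better_def z(3))
      note o = lex_prefD(2)[OF L i(1)]
      have "y ! i \<noteq> c i" using i(2) o by (auto simp: strict_linear_order_on_def irrefl_def)
      then have "(c i, y ! i) \<in> snd L i"
        using c(2)[of i "y ! i"] i(1) y by (auto simp: bundles_def available_def)
      then show False using i(2) strict_linear_order_on_asym[OF o] by blast
    qed
  qed
  then show "x \<in> bundles n p" "\<And>i. i < p \<Longrightarrow> 0 < s i (x ! i)"
    "\<And>i b. i < p \<Longrightarrow> b < n \<Longrightarrow> 0 < s i b \<Longrightarrow> b \<noteq> x ! i \<Longrightarrow> (x ! i, b) \<in> snd L i"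
    using z c by simp_all
qed

section \<open>The eating algorithm\<close>

text \<open>One phase advances the clocks of all remaining items by \<open>d\<close>. Items better
  than the favourite \<open>c\<close> are exhausted, so nothing about them changes. Items worse than
  \<open>c\<close> had share 0 and keep it, since their start time is at least the clock of
  \<open>c\<close>, which no clock exceeds. Only \<open>c\<close> gains.\<close>

lemma share_eating_step:
  assumes "finite A" and D: "strict_linear_order_on A D" and c: "c \<in> A" "0 < s c"
    and best: "\<And>b. b \<in> A \<Longrightarrow> 0 < s b \<Longrightarrow> b \<noteq> c \<Longrightarrow> (c, b) \<in> D"
    and \<tau>: "\<And>b. b \<in> A \<Longrightarrow> \<tau> b \<le> t" "\<And>b. b \<in> A \<Longrightarrow> 0 < s b \<Longrightarrow> \<tau> b = t" "0 \<le> t" and "0 \<le> d" "a \<in> A"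
  defines "\<tau>' \<equiv> \<lambda>b. \<tau> b + (if 0 < s b then d else 0)"
  shows "share A D \<tau>' a = share A D \<tau> a + (if a = c then d else 0)"
proof -
  have irr: "(b, b) \<notin> D" for b using D by (auto simp: strict_linear_order_on_def irrefl_def)
  have gone: "\<not> 0 < s b" if "b \<in> A" "(b, c) \<in> D" for b
    using that best[of b] irr strict_linear_order_on_asym[OF D] by metis
  have same_start: "start_time A D \<tau>' b = start_time A D \<tau> b" if "b = c \<or> (b, c) \<in> D" for b
  proof -
    have "\<tau>' e = \<tau> e" if "e \<in> A" "(e, b) \<in> D" for e
    proof -
      have "(e, c) \<in> D"
        using that \<open>b = c \<or> (b, c) \<in> D\<close> D by (auto simp: strict_linear_order_on_def dest: transD)
      then show ?thesis using gone that by (simp add: \<tau>'_def)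
    qed
    then have "\<tau>' ` {e \<in> A. (e, b) \<in> D} = \<tau> ` {e \<in> A. (e, b) \<in> D}"
      by (intro image_cong) auto
    then show ?thesis by (simp add: start_time_def)
  qed
  consider "a = c" | "(a, c) \<in> D" | "a \<noteq> c" "(c, a) \<in> D"
    using D c \<open>a \<in> A\<close> by (auto simp: strict_linear_order_on_def total_on_def)
  then show ?thesis
  proof cases
    case 1
    have "start_time A D \<tau> c \<le> t"
      using \<tau> \<open>finite A\<close> by (intro start_time_le) auto
    then show ?thesis
      using 1 same_start[of c] c \<tau>(2)[of c] \<open>0 \<le> d\<close> by (simp add: share_def \<tau>'_def)
  next
    case 2
    then show ?thesis using same_start[of a] gone[of a] \<open>a \<in> A\<close> irr
      by (auto simp: share_def \<tau>'_def)
  next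
    case 3
    have "t \<le> start_time A D \<tau> a"
      using le_start_time[of A c a D \<tau>] 3 c \<tau>(2)[of c] \<open>finite A\<close> by simp
    moreover have "t + d \<le> start_time A D \<tau>' a"
      using le_start_time[of A c a D \<tau>'] 3 c \<tau>(2)[of c] \<open>finite A\<close> by (simp add: \<tau>'_def)
    moreover have "\<tau> a \<le> t" "\<tau>' a \<le> t + d"
      using \<tau>(1)[of a] \<open>a \<in> A\<close> \<open>0 \<le> d\<close> by (auto simp: \<tau>'_def)
    ultimately show ?thesis using 3 by (simp add: share_def)
  qed
qed

text \<open>Here \<open>t\<close> is the time elapsed, and \<open>\<tau> i a\<close> the time for which item \<open>a\<close> of type \<open>i\<close> has been
  available so far.\<close>

definition mps_invar :: "nat \<Rightarrow> nat \<Rightarrow> (nat \<Rightarrow> pref) \<Rightarrow> real \<Rightarrow> (nat \<Rightarrow> nat \<Rightarrow> real) \<Rightarrow>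
    (nat \<Rightarrow> nat \<Rightarrow> real) \<times> (nat \<Rightarrow> nat list \<Rightarrow> real) \<Rightarrow> bool" where
  "mps_invar n p R t \<tau> st \<longleftrightarrow> 0 \<le> t \<and>
     (\<forall>i<p. \<forall>a<n. 0 \<le> fst st i a \<and> 0 \<le> \<tau> i a \<and> \<tau> i a \<le> t \<and> (0 < fst st i a \<longrightarrow> \<tau> i a = t) \<and>
        fst st i a = 1 - (\<Sum>k<n. share {0..<n} (snd (R k) i) (\<tau> i) a)) \<and>
     (\<forall>k<n. (\<Sum>x\<in>bundles n p. snd st k x) = t \<and>
        (\<forall>i<p. \<forall>a<n. marginal n p (snd st k) i a = share {0..<n} (snd (R k) i) (\<tau> i) a))"

lemma mps_invarD:
  assumes "mps_invar n p R t \<tau> st"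
  shows "0 \<le> t"
    and "\<And>i a. i < p \<Longrightarrow> a < n \<Longrightarrow> 0 \<le> fst st i a"
    and "\<And>i a. i < p \<Longrightarrow> a < n \<Longrightarrow> 0 \<le> \<tau> i a"
    and "\<And>i a. i < p \<Longrightarrow> a < n \<Longrightarrow> \<tau> i a \<le> t"
    and "\<And>i a. i < p \<Longrightarrow> a < n \<Longrightarrow> 0 < fst st i a \<Longrightarrow> \<tau> i a = t"
    and "\<And>i a. i < p \<Longrightarrow> a < n \<Longrightarrow>
      fst st i a = 1 - (\<Sum>k<n. share {0..<n} (snd (R k) i) (\<tau> i) a)"
    and "\<And>k. k < n \<Longrightarrow> (\<Sum>x\<in>bundles n p. snd st k x) = t"
    and "\<And>k i a. k < n \<Longrightarrow> i < p \<Longrightarrow> a < n \<Longrightarrow>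
      marginal n p (snd st k) i a = share {0..<n} (snd (R k) i) (\<tau> i) a"
  using assms unfolding mps_invar_def by blast+

definition alive :: "nat \<Rightarrow> nat \<Rightarrow> (nat \<Rightarrow> nat \<Rightarrow> real) \<Rightarrow> (nat \<times> nat) set" where
  "alive n p s = {(i, a). i < p \<and> a < n \<and> 0 < s i a}"

lemma finite_alive: "finite (alive n p s)"
  by (rule finite_subset[of _ "{0..<p} \<times> {0..<n}"]) (auto simp: alive_def)

text \<open>By time \<open>t\<close> each of the \<open>n\<close> agents has eaten bundles of total
  weight \<open>t\<close>, hence \<open>t\<close> units of every type.\<close>

lemma mps_invar_sum_supply:
  assumes "mps_invar n p R t \<tau> st" "i < p"
  shows "(\<Sum>a<n. fst st i a) = real n * (1 - t)"
proof -
  let ?m = "\<lambda>k a. marginal n p (snd st k) i a"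
  have "fst st i a = 1 - (\<Sum>k<n. ?m k a)" if "a < n" for a
    using mps_invarD(6,8)[OF assms(1)] assms(2) that by simp
  then have "(\<Sum>a<n. fst st i a) = (\<Sum>a<n. 1 - (\<Sum>k<n. ?m k a))" by (intro sum.cong) auto
  also have "\<dots> = real n - (\<Sum>k<n. \<Sum>a<n. ?m k a)"
    by (subst sum.swap) (simp add: sum_subtractf)
  also have "(\<Sum>k<n. \<Sum>a<n. ?m k a) = (\<Sum>k<n. t)"
  proof (intro sum.cong refl)
    fix k assume "k \<in> {..<n}"
    then show "(\<Sum>a<n. ?m k a) = t"
      using assms(1) unfolding sum_marginal_all[OF assms(2)] by (simp add: mps_invarD(7))
  qed
  finally show ?thesis by (simp add: algebra_simps)
qed

text \<open>The remaining supply totals \<open>n * (1 - t)\<close> in every type alike, so one type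
  cannot run out before the others.\<close>

lemma mps_invar_exhausted:
  assumes inv: "mps_invar n p R t \<tau> st" and "0 < n" "i < p" "\<And>a. a < n \<Longrightarrow> fst st i a \<le> 0"
  shows "t = 1" and "alive n p (fst st) = {}"
proof -
  have "fst st i a = 0" if "a < n" for a
    using assms(4)[OF that] mps_invarD(2)[OF inv \<open>i < p\<close> that] by simp
  then have "real n * (1 - t) = 0"
    using mps_invar_sum_supply[OF inv \<open>i < p\<close>] by simp
  then show t: "t = 1" using \<open>0 < n\<close> by simp
  have "fst st i' a = 0" if "i' < p" "a < n" for i' a
  proof -
    have "(\<Sum>a<n. fst st i' a) = 0" using mps_invar_sum_supply[OF inv \<open>i' < p\<close>] t by simp
    then show ?thesis
      using mps_invarD(2)[OF inv \<open>i' < p\<close>] \<open>a < n\<close> by (subst (asm) sum_nonneg_eq_0_iff) auto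
  qed
  then show "alive n p (fst st) = {}" by (auto simp: alive_def)
qed

lemma mps_invar_step:
  assumes R: "\<forall>k<n. lex_pref n p (R k)" and np: "0 < n" "0 < p" and inv: "mps_invar n p R t \<tau> (s, P)"
    and ex: "\<exists>x\<in>bundles n p. available p s x"
  obtains t' \<tau>' where "mps_invar n p R t' \<tau>' (mps_step n p R (s, P))"
    "alive n p (fst (mps_step n p R (s, P))) \<subset> alive n p s"
proof -
  define x where "x k = top_bundle n p (R k) s" for k
  define e where "e i a = real (eaters n p R s i a)" for i a
  define M where "M = {s i a / real (eaters n p R s i a) | i a. i < p \<and> a < n \<and> 0 < eaters n p R s i a}"
  define d where "d = Min M"
  define s' where "s' i a = s i a - d * e i a" for i a
  define P' where "P' k y = P k y + (if k < n \<and> y = x k then d else 0)" for k y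
  define \<tau>' where "\<tau>' i a = \<tau> i a + (if 0 < s i a then d else 0)" for i a
  have step: "mps_step n p R (s, P) = (s', P')"
    using ex unfolding mps_step_def s'_def[abs_def] P'_def[abs_def] d_def M_def e_def x_def
    by (simp add: Let_def)
  have M_def: "M = {s i a / e i a | i a. i < p \<and> a < n \<and> 0 < e i a}"
    by (simp add: M_def e_def)
  have top: "x k \<in> bundles n p" "i < p \<Longrightarrow> 0 < s i (x k ! i)"
    "i < p \<Longrightarrow> b < n \<Longrightarrow> 0 < s i b \<Longrightarrow> b \<noteq> x k ! i \<Longrightarrow> (x k ! i, b) \<in> snd (R k) i" if "k < n" for k i b
    using top_bundle_componentwise[OF _ ex, of "R k"] R that by (auto simp: x_def)
  have top_less: "x k ! i < n" if "k < n" "i < p" for k i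
    using top(1)[OF that(1)] that by (simp add: bundles_def)
  have e_eq: "e i a = (\<Sum>k<n. if a = x k ! i then 1 else 0)" for i a
  proof -
    have "{j. j < n \<and> top_bundle n p (R j) s ! i = a} = {k \<in> {..<n}. a = x k ! i}"
      by (auto simp: x_def)
    then show ?thesis by (simp add: e_def eaters_def sum.If_cases Int_def)
  qed
  have eaten_alive: "0 < s i a" if "i < p" "0 < e i a" for i a
  proof -
    have "\<exists>k<n. a = x k ! i"
    proof (rule ccontr)
      assume "\<not> ?thesis"
      then have "e i a = 0" unfolding e_eq by (intro sum.neutral) auto
      then show False using that by simp
    qed
    then show ?thesis using top(2) that by blast
  qed
  have e0: "0 \<le> e i a" for i a by (simp add: e_def)
  have "finite M"
  proof (rule finite_subset)
    show "M \<subseteq> (\<lambda>(i, a). s i a / e i a) ` ({0..<p} \<times> {0..<n})" by (force simp: M_def)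
  qed simp
  \<comment> \<open>Agent 0 eats some item of type 0; both exist because \<open>n\<close> and
    \<open>p\<close> are positive.\<close>
  have "M \<noteq> {}"
  proof -
    have "0 < (\<Sum>k<n. if x 0 ! 0 = x k ! 0 then 1 else (0::real))"
      using np by (intro sum_pos2[of _ 0]) auto
    then have "0 < e 0 (x 0 ! 0)" by (simp add: e_eq)
    then show ?thesis using np top_less[of 0 0] by (auto simp: M_def)
  qed
  have "d \<in> M" unfolding d_def using \<open>finite M\<close> \<open>M \<noteq> {}\<close> by (rule Min_in)
  then obtain i0 a0 where d: "d = s i0 a0 / e i0 a0" "i0 < p" "a0 < n" "0 < e i0 a0"
    by (auto simp: M_def)
  have s0: "0 < s i0 a0" using eaten_alive d by blast
  have "0 < d" using d s0 by simp
  have s'0: "0 \<le> s' i a" if "i < p" "a < n" for i a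
  proof (cases "0 < e i a")
    case True
    then have "d \<le> s i a / e i a"
      unfolding d_def using that \<open>finite M\<close> by (intro Min_le) (auto simp: M_def)
    then show ?thesis using True by (simp add: s'_def field_simps)
  next
    case False
    then have "e i a = 0" using e0[of i a] by simp
    then show ?thesis using mps_invarD(2)[OF inv that] by (simp add: s'_def)
  qed
  have s'_le: "s' i a \<le> s i a" for i a
    using e0[of i a] \<open>0 < d\<close> by (simp add: s'_def)
  have share': "share {0..<n} (snd (R k) i) (\<tau>' i) a =
      share {0..<n} (snd (R k) i) (\<tau> i) a + (if a = x k ! i then d else 0)"
    if "k < n" "i < p" "a < n" for k i a
    unfolding \<tau>'_def
  proof (rule share_eating_step[where t = t])
    show "strict_linear_order_on {0..<n} (snd (R k) i)" using R that lex_prefD(2) by blast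
    show "x k ! i \<in> {0..<n}" "0 < s i (x k ! i)" using top_less top(2) that by auto
    show "(x k ! i, b) \<in> snd (R k) i" if "b \<in> {0..<n}" "0 < s i b" "b \<noteq> x k ! i" for b
      using top(3)[OF \<open>k < n\<close> \<open>i < p\<close> _ that(2,3)] that(1) by simp
    show "\<tau> i b \<le> t" if "b \<in> {0..<n}" for b
      using mps_invarD(4)[OF inv \<open>i < p\<close>] that by simp
    show "\<tau> i b = t" if "b \<in> {0..<n}" "0 < s i b" for b
      using mps_invarD(5)[OF inv \<open>i < p\<close>] that by simp
  qed (use mps_invarD(1)[OF inv] \<open>0 < d\<close> that in auto)
  have marg': "marginal n p (P' k) i a = marginal n p (P k) i a + (if a = x k ! i then d else 0)"
    if "k < n" for k i a
    using top(1)[OF that] finite_bundles that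
    by (auto simp: marginal_def P'_def sum.distrib sum.delta)
  have total': "(\<Sum>y\<in>bundles n p. P' k y) = (\<Sum>y\<in>bundles n p. P k y) + d" if "k < n" for k
    using top(1)[OF that] finite_bundles that by (simp add: P'_def sum.distrib sum.delta)
  have supply': "s' i a = 1 - (\<Sum>k<n. share {0..<n} (snd (R k) i) (\<tau>' i) a)"
    if "i < p" "a < n" for i a
  proof -
    have "(\<Sum>k<n. share {0..<n} (snd (R k) i) (\<tau>' i) a)
        = (\<Sum>k<n. share {0..<n} (snd (R k) i) (\<tau> i) a + d * (if a = x k ! i then 1 else 0))"
      using share' that by (intro sum.cong) auto
    also have "\<dots> = (\<Sum>k<n. share {0..<n} (snd (R k) i) (\<tau> i) a) + d * e i a"
      by (simp add: sum.distrib e_eq sum_distrib_left)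
    finally show ?thesis using mps_invarD(6)[OF inv that] by (simp add: s'_def)
  qed
  have alive': "\<tau>' i a = t + d" if "i < p" "a < n" "0 < s' i a" for i a
    using mps_invarD(5)[OF inv that(1,2)] that s'_le[of i a] by (simp add: \<tau>'_def)
  have "mps_invar n p R (t + d) \<tau>' (s', P')"
    unfolding mps_invar_def
  proof (intro conjI allI impI)
    show "0 \<le> t + d" using mps_invarD(1)[OF inv] \<open>0 < d\<close> by simp
    show "fst (s', P') i a = 1 - (\<Sum>k<n. share {0..<n} (snd (R k) i) (\<tau>' i) a)"
      if "i < p" "a < n" for i a using supply'[OF that] by simp
    show "(\<Sum>y\<in>bundles n p. snd (s', P') k y) = t + d" if "k < n" for k
      using total'[OF that] mps_invarD(7)[OF inv that] by simp
    show "marginal n p (snd (s', P') k) i a = share {0..<n} (snd (R k) i) (\<tau>' i) a"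
      if "k < n" "i < p" "a < n" for k i a
      using mps_invarD(8)[OF inv that] marg'[OF that(1)] share'[OF that] by simp
  next
    fix i a assume ia: "i < p" "a < n"
    show "0 \<le> \<tau>' i a" using mps_invarD(3)[OF inv ia] \<open>0 < d\<close> by (simp add: \<tau>'_def)
    show "\<tau>' i a \<le> t + d" using mps_invarD(4)[OF inv ia] \<open>0 < d\<close> by (simp add: \<tau>'_def)
  qed (use s'0 alive' in auto)
  moreover have "alive n p s' \<subset> alive n p s"
  proof
    show "alive n p s' \<subseteq> alive n p s"
      using s'_le by (auto simp: alive_def intro: less_le_trans)
    \<comment> \<open>The item attaining the minimum \<open>d\<close> is eaten up exactly at the end
      of the phase.\<close>
    have "s' i0 a0 = 0" using d by (simp add: s'_def)
    then have "(i0, a0) \<in> alive n p s - alive n p s'" using s0 d by (simp add: alive_def)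
    then show "alive n p s' \<noteq> alive n p s" by blast
  qed
  ultimately show ?thesis using that by (simp add: step)
qed

text \<open>Each phase exhausts an item, or the process has stopped, and then nothing is left at
  all; this justifies the number \<open>n * p\<close> of phases.\<close>

lemma mps_invar_iterate:
  assumes R: "\<forall>k<n. lex_pref n p (R k)" and np: "0 < n" "0 < p"
  shows "\<exists>t \<tau>. mps_invar n p R t \<tau> ((mps_step n p R ^^ m) (\<lambda>i a. 1, \<lambda>j x. 0)) \<and>
    card (alive n p (fst ((mps_step n p R ^^ m) (\<lambda>i a. 1, \<lambda>j x. 0)))) \<le> n * p - m"
proof (induction m)
  case 0
  have "share {0..<n} (snd (R k) i) (\<lambda>a. 0) a = 0" for k i a
    using start_time_nonneg[of "{0..<n}" "snd (R k) i" "\<lambda>a. 0" a] by (simp add: share_def)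
  then have "mps_invar n p R 0 (\<lambda>i a. 0) (\<lambda>i a. 1, \<lambda>j x. 0)"
    by (simp add: mps_invar_def marginal_def)
  moreover have "card (alive n p (\<lambda>i a. 1)) \<le> card ({0..<p} \<times> {0..<n})"
    by (intro card_mono) (auto simp: alive_def)
  ultimately show ?case by (auto simp: mult.commute)
next
  case (Suc m)
  define st where "st = (mps_step n p R ^^ m) (\<lambda>i a. 1, \<lambda>j x. 0)"
  obtain s P where sP: "st = (s, P)" by fastforce
  from Suc obtain t \<tau> where inv: "mps_invar n p R t \<tau> (s, P)"
    and le: "card (alive n p s) \<le> n * p - m" by (auto simp flip: st_def simp: sP)
  have next_st: "(mps_step n p R ^^ Suc m) (\<lambda>i a. 1, \<lambda>j x. 0) = mps_step n p R (s, P)"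
    by (simp flip: st_def sP)
  show ?case
    unfolding next_st
  proof (cases "\<exists>x\<in>bundles n p. available p s x")
    case True
    obtain t' \<tau>' where inv': "mps_invar n p R t' \<tau>' (mps_step n p R (s, P))"
      and less: "alive n p (fst (mps_step n p R (s, P))) \<subset> alive n p s"
      using mps_invar_step[OF R np inv True] by blast
    have "card (alive n p (fst (mps_step n p R (s, P)))) < card (alive n p s)"
      using less finite_alive by (intro psubset_card_mono)
    then show "\<exists>t \<tau>. mps_invar n p R t \<tau> (mps_step n p R (s, P)) \<and>
        card (alive n p (fst (mps_step n p R (s, P)))) \<le> n * p - Suc m"
      using inv' le by (intro exI[of _ t'] exI[of _ \<tau>']) auto
  next
    case False
    then have step: "mps_step n p R (s, P) = (s, P)" by (simp add: mps_step_def)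
    \<comment> \<open>If every type had a remaining item, one from each type would form an available
      bundle.\<close>
    have "\<exists>i<p. \<forall>a<n. s i a \<le> 0"
    proof (rule ccontr)
      assume "\<not> ?thesis"
      then obtain c where c: "\<And>i. i < p \<Longrightarrow> c i < n \<and> 0 < s i (c i)"
        by (metis not_le)
      then have "map c [0..<p] \<in> bundles n p" "available p s (map c [0..<p])"
        by (auto simp: bundles_def available_def)
      with False show False by blast
    qed
    then have "alive n p s = {}"
      using mps_invar_exhausted(2)[OF inv np(1)] by auto
    then show "\<exists>t \<tau>. mps_invar n p R t \<tau> (mps_step n p R (s, P)) \<and>
        card (alive n p (fst (mps_step n p R (s, P)))) \<le> n * p - Suc m"
      using inv step by auto
  qed
qed

text \<open>The interface to the incentive argument: for positive \<open>p\<close>, nothing else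
  about the algorithm is used below.\<close>

theorem mps_exhaustion_times:
  assumes R: "\<forall>k<n. lex_pref n p (R k)" and np: "0 < n" "0 < p"
  obtains \<tau> where
    "\<And>i a. i < p \<Longrightarrow> a < n \<Longrightarrow> 0 \<le> \<tau> i a \<and> \<tau> i a \<le> (1::real)"
    "\<And>i a. i < p \<Longrightarrow> a < n \<Longrightarrow> (\<Sum>k<n. share {0..<n} (snd (R k) i) (\<tau> i) a) = 1"
    "\<And>k i a. k < n \<Longrightarrow> i < p \<Longrightarrow> a < n \<Longrightarrow>
      marginal n p (mps n p R k) i a = share {0..<n} (snd (R k) i) (\<tau> i) a"
    "\<And>k. k < n \<Longrightarrow> (\<Sum>x\<in>bundles n p. mps n p R k x) = 1"
proof -
  define st where "st = (mps_step n p R ^^ (n * p)) (\<lambda>i a. 1, \<lambda>j x. 0)"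
  obtain t \<tau> where inv: "mps_invar n p R t \<tau> st" and "card (alive n p (fst st)) = 0"
    using mps_invar_iterate[OF R np, of "n * p"] by (auto simp: st_def)
  then have "alive n p (fst st) = {}" using finite_alive by simp
  then have gone: "fst st i a \<le> 0" if "i < p" "a < n" for i a
    using that unfolding alive_def by (force simp: not_less[symmetric])
  have t: "t = 1" using mps_invar_exhausted(1)[OF inv np gone] np by blast
  have z: "fst st i a = 0" if "i < p" "a < n" for i a
    using gone[OF that] mps_invarD(2)[OF inv that] by simp
  have mps: "mps n p R = snd st" by (simp add: mps_def st_def)
  show ?thesis
  proof (rule that[of \<tau>])
    fix i a assume "i < p" "a < n"
    then show "(\<Sum>k<n. share {0..<n} (snd (R k) i) (\<tau> i) a) = 1"
      using z[of i a] mps_invarD(6)[OF inv, of i a] by simp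
  qed (use mps_invarD(3,4,7,8)[OF inv] t mps in auto)
qed

section \<open>From marginals to bundles\<close>

text \<open>Unions of classes of bundles agreeing on \<open>K\<close>, i.e. the sets of bundles
  determined by the components in \<open>K\<close>.\<close>

definition saturated :: "nat \<Rightarrow> nat \<Rightarrow> nat set \<Rightarrow> nat list set \<Rightarrow> bool" where
  "saturated n p K S \<longleftrightarrow> S \<subseteq> bundles n p \<and>
     (\<forall>x\<in>S. \<forall>y\<in>bundles n p. (\<forall>i\<in>K. y ! i = x ! i) \<longrightarrow> y \<in> S)"

text \<open>The default 0 outside \<open>K\<close> turns the restriction of a bundle to
  \<open>K\<close> into a function that can index its class.\<close>

lemma sum_by_class:
  fixes f :: "nat list \<Rightarrow> real"
  assumes "finite S"
  shows "sum f S = (\<Sum>g\<in>(\<lambda>x i. if i \<in> K then x ! i else 0) ` S.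
    \<Sum>y | y \<in> S \<and> (\<lambda>i. if i \<in> K then y ! i else 0) = g. f y)"
  using assms by (intro sum.group[symmetric]) auto

lemma class_eq_iff:
  "(\<lambda>i. if i \<in> K then y ! i else 0) = (\<lambda>i. if i \<in> K then x ! i else (0::nat)) \<longleftrightarrow>
   (\<forall>i\<in>K. y ! i = x ! i)"
  by (auto simp: fun_eq_iff)

lemma saturated_sum_eq_0:
  fixes f :: "nat list \<Rightarrow> real"
  assumes "saturated n p K S"
    and zero: "\<And>x. x \<in> S \<Longrightarrow> (\<Sum>y | y \<in> bundles n p \<and> (\<forall>i\<in>K. y ! i = x ! i). f y) = 0"
  shows "sum f S = 0"
proof -
  have "finite S" using assms(1) finite_bundles finite_subset by (auto simp: saturated_def)
  have "{y. y \<in> S \<and> (\<forall>i\<in>K. y ! i = x ! i)} =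
      {y. y \<in> bundles n p \<and> (\<forall>i\<in>K. y ! i = x ! i)}" if "x \<in> S" for x
    using assms(1) that by (auto simp: saturated_def)
  then show ?thesis
    using zero unfolding sum_by_class[OF \<open>finite S\<close>, of f K]
    by (intro sum.neutral) (auto simp only: class_eq_iff image_iff)
qed

text \<open>At the best item where \<open>h\<close> is nonzero, the cumulative sum reduces to that
  single value.\<close>

lemma sums_better_eq_0_imp_eq_0:
  fixes h :: "'a \<Rightarrow> real"
  assumes "finite A" "strict_linear_order_on A D"
    and zero: "\<And>a. a \<in> A \<Longrightarrow> (\<Sum>b | b \<in> A \<and> (b = a \<or> (b, a) \<in> D). h b) = 0"
    and "a \<in> A"
  shows "h a = 0"
proof (rule ccontr)
  assume "h a \<noteq> 0"
  let ?B = "{b \<in> A. h b \<noteq> 0}"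
  have ne: "?B \<noteq> {}" using \<open>h a \<noteq> 0\<close> \<open>a \<in> A\<close> by auto
  obtain w where w: "w \<in> ?B" "\<And>b. b \<in> ?B \<Longrightarrow> b \<noteq> w \<Longrightarrow> (w, b) \<in> D"
    by (rule finite_best_exists[OF _ ne assms(2)]) (use assms(1) in auto)
  have "h b = 0" if "b \<in> A" "(b, w) \<in> D" "b \<noteq> w" for b
    using that w(2)[of b] strict_linear_order_on_asym[OF assms(2)] by blast
  then have "(\<Sum>b | b \<in> A \<and> (b = w \<or> (b, w) \<in> D). h b) = (\<Sum>b\<in>{w}. h b)"
    using assms(1) w(1) by (intro sum.mono_neutral_right) auto
  then show False using zero[of w] w(1) by simp
qed

text \<open>The witness takes the components of \<open>x\<close> on the types above \<open>w\<close>, item \<open>a\<close> in type \<open>w\<close>, and the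
  worst item in every type below.\<close>

lemma upper_set_prefix:
  assumes L: "lex_pref n p L" and x: "x \<in> bundles n p" and w: "w < p" and a: "a < n"
  defines "K \<equiv> {i. i < p \<and> (i, w) \<in> fst L}"
  obtains z where "z \<in> bundles n p"
    "upper_set n p L z =
      {y \<in> bundles n p. \<exists>i\<in>K. (y ! i, x ! i) \<in> snd L i \<and> (\<forall>i'<p. (i', i) \<in> fst L \<longrightarrow> y ! i' = x ! i')} \<union>
      {y \<in> bundles n p. (\<forall>i\<in>K. y ! i = x ! i) \<and> (y ! w = a \<or> (y ! w, a) \<in> snd L w)}"
proof -
  note oL = lex_prefD(1)[OF L]
  have tr: "trans (fst L)" and irr: "\<And>i. (i, i) \<notin> fst L" and tot: "total_on {0..<p} (fst L)"
    using oL by (auto simp: strict_linear_order_on_def irrefl_def)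
  have irr2: "(b, b) \<notin> snd L i" if "i < p" for b i
    using lex_prefD(2)[OF L that] by (auto simp: strict_linear_order_on_def irrefl_def)
  have "\<forall>i. \<exists>c. i < p \<longrightarrow> c < n \<and> (\<forall>b<n. b \<noteq> c \<longrightarrow> (b, c) \<in> snd L i)"
  proof
    fix i
    show "\<exists>c. i < p \<longrightarrow> c < n \<and> (\<forall>b<n. b \<noteq> c \<longrightarrow> (b, c) \<in> snd L i)"
    proof (cases "i < p")
      case True
      obtain c where "c \<in> {0..<n}" "\<And>b. b \<in> {0..<n} \<Longrightarrow> b \<noteq> c \<Longrightarrow> (b, c) \<in> snd L i"
        by (rule finite_worst_exists[OF _ _ lex_prefD(2)[OF L True], of "{0..<n}"]) (use a in auto)
      then show ?thesis by auto
    qed simp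
  qed
  then obtain c where c: "\<And>i. i < p \<Longrightarrow> c i < n"
      "\<And>i b. i < p \<Longrightarrow> b < n \<Longrightarrow> b \<noteq> c i \<Longrightarrow> (b, c i) \<in> snd L i"
    by (metis (no_types, lifting) choice)
  define z where "z = map (\<lambda>i. if i \<in> K then x ! i else if i = w then a else c i) [0..<p]"
  have wK: "w \<notin> K" using irr by (simp add: K_def)
  have zb: "z \<in> bundles n p" using x a c(1) by (auto simp: z_def bundles_def)
  have zK: "z ! i = x ! i" if "i \<in> K" for i using that by (simp add: z_def K_def)
  have zw: "z ! w = a" using wK w by (simp add: z_def)
  have zc: "z ! i = c i" if "i < p" "i \<notin> K" "i \<noteq> w" for i using that by (simp add: z_def)
  have closed: "i' \<in> K" if "i \<in> K" "i' < p" "(i', i) \<in> fst L" for i i'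
    using that tr by (auto simp: K_def dest: transD)
  \<comment> \<open>\<open>insert w K\<close> is an initial segment of the importance order.\<close>
  have above: "(i, j) \<in> fst L" if "i \<in> insert w K" "j < p" "j \<notin> insert w K" for i j
  proof -
    have "(w, j) \<in> fst L"
      using tot that(2,3) w unfolding total_on_def K_def by force
    then show ?thesis using that tr by (auto simp: K_def dest: transD)
  qed
  let ?H = "{y \<in> bundles n p. \<exists>i\<in>K. (y ! i, x ! i) \<in> snd L i \<and>
    (\<forall>i'<p. (i', i) \<in> fst L \<longrightarrow> y ! i' = x ! i')}"
  let ?G = "{y \<in> bundles n p. (\<forall>i\<in>K. y ! i = x ! i) \<and> (y ! w = a \<or> (y ! w, a) \<in> snd L w)}"
  have "upper_set n p L z = ?H \<union> ?G"
  proof (intro set_eqI iffI)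
    fix y assume "y \<in> upper_set n p L z"
    then consider "y = z" | "y \<in> bundles n p" "lex_better p L y z" by (auto simp: upper_set_def)
    then show "y \<in> ?H \<union> ?G"
    proof cases
      case 1
      then show ?thesis using zb zK zw by auto
    next
      case 2
      then obtain i where i: "i < p" "(y ! i, z ! i) \<in> snd L i"
        "\<And>i'. i' < p \<Longrightarrow> (i', i) \<in> fst L \<Longrightarrow> y ! i' = z ! i'"
        by (auto simp: lex_better_def)
      consider "i \<in> K" | "i = w" | "i < p" "i \<notin> insert w K" using i(1) by blast
      then show ?thesis
      proof cases
        assume iK: "i \<in> K"
        then have "(y ! i, x ! i) \<in> snd L i" using i(2) zK by simp
        moreover have "y ! i' = x ! i'" if "i' < p" "(i', i) \<in> fst L" for i'
          using i(3)[OF that] zK[OF closed[OF iK that]] by simp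
        ultimately show ?thesis using iK 2(1) by blast
      next
        assume iw: "i = w"
        then have "y ! i' = x ! i'" if "i' \<in> K" for i'
          using i(3)[of i'] that zK[OF that] by (simp add: K_def)
        then show ?thesis using iw i(2) zw 2(1) by auto
      next
        assume *: "i < p" "i \<notin> insert w K"
        have "y ! i' = z ! i'" if "i' \<in> insert w K" for i'
          using i(3)[of i'] above[OF that *] that w by (auto simp: K_def)
        then show ?thesis using zK zw 2(1) by auto
      qed
    qed
  next
    fix y assume "y \<in> ?H \<union> ?G"
    then show "y \<in> upper_set n p L z"
    proof
      assume "y \<in> ?H"
      then obtain i where y: "y \<in> bundles n p" and i: "i \<in> K" "(y ! i, x ! i) \<in> snd L i"
        "\<And>i'. i' < p \<Longrightarrow> (i', i) \<in> fst L \<Longrightarrow> y ! i' = x ! i'" by blast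
      have "lex_better p L y z"
        unfolding lex_better_def
      proof (intro exI[of _ i] conjI allI impI)
        fix i' assume "i' < p" "(i', i) \<in> fst L"
        then show "y ! i' = z ! i'" using i(3)[of i'] zK[OF closed[OF i(1)]] by simp
      qed (use i zK in \<open>auto simp: K_def\<close>)
      then show ?thesis using y by (simp add: upper_set_def)
    next
      assume "y \<in> ?G"
      then have y: "y \<in> bundles n p" "\<And>i. i \<in> K \<Longrightarrow> y ! i = x ! i"
        "y ! w = a \<or> (y ! w, a) \<in> snd L w" by auto
      show ?thesis
      proof (cases "y = z")
        case True
        then show ?thesis by (simp add: upper_set_def)
      next
        case False
        then obtain i where i: "i < p" "y ! i \<noteq> z ! i"
          "\<And>i'. i' < p \<Longrightarrow> (i', i) \<in> fst L \<Longrightarrow> y ! i' = z ! i'"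
          using first_difference[OF L y(1) zb] by metis
        have "i \<notin> K" using i(2) y(2) zK by auto
        \<comment> \<open>The first difference is either at \<open>w\<close>, where membership in
          \<open>?G\<close> decides, or below \<open>w\<close>, where \<open>z\<close> holds the
          worst item.\<close>
        have "(y ! i, z ! i) \<in> snd L i"
        proof (cases "i = w")
          case True
          then show ?thesis using i(2) y(3) zw by auto
        next
          case False
          then show ?thesis
            using c(2)[OF i(1), of "y ! i"] zc[OF i(1) \<open>i \<notin> K\<close> False] i(1,2) y(1)
            by (auto simp: bundles_def)
        qed
        then show ?thesis using i y(1) by (auto simp: upper_set_def lex_better_def)
      qed
    qed
  qed
  then show ?thesis using that zb by blast
qed

text \<open>Induction over the sets \<open>K\<close> of types closed under greater importance, adding the least
  important one, \<open>w\<close>: dominance on the upper sets of \<open>upper_set_prefix\<close> gives an inequality within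
  each class of bundles agreeing above \<open>w\<close>. Summed over the classes it is dominance of the
  marginals of type \<open>w\<close>, so if these are equal then so is every summand.\<close>

lemma lex_sd_geq_imp_eq:
  assumes L: "lex_pref n p L" and sd: "sd_geq n p L Q P"
    and total: "(\<Sum>x\<in>bundles n p. Q x) = (\<Sum>x\<in>bundles n p. P x)"
    and marg: "\<And>i a. i < p \<Longrightarrow> a < n \<Longrightarrow>
      (\<And>a. a < n \<Longrightarrow> (\<Sum>b | b < n \<and> (b = a \<or> (b, a) \<in> snd L i). marginal n p P i b) \<le>
        (\<Sum>b | b < n \<and> (b = a \<or> (b, a) \<in> snd L i). marginal n p Q i b)) \<Longrightarrow>
      marginal n p Q i a = marginal n p P i a"
    and "x \<in> bundles n p"
  shows "Q x = P x"
proof -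
  define f where "f y = Q y - P y" for y
  note oL = lex_prefD(1)[OF L]
  have tr: "trans (fst L)" and irr: "\<And>i. (i, i) \<notin> fst L"
    using oL by (auto simp: strict_linear_order_on_def irrefl_def)
  \<comment> \<open>The case \<open>K = {}\<close> is equality of total weights; with all types in
    \<open>K\<close>, singletons are saturated.\<close>
  have "sum f S = 0"
    if "finite K" "K \<subseteq> {0..<p}" "\<And>i i'. i \<in> K \<Longrightarrow> i' < p \<Longrightarrow> (i', i) \<in> fst L \<Longrightarrow> i' \<in> K"
      "saturated n p K S" for K S
    using that
  proof (induction K arbitrary: S rule: finite_psubset_induct)
    case (psubset K)
    show ?case
    proof (cases "K = {}")
      case True
      then have "S = {} \<or> S = bundles n p" using psubset.prems(3) by (auto simp: saturated_def)
      then show ?thesis using total by (auto simp: f_def sum_subtractf)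
    next
      case False
      obtain w where w: "w \<in> K" "\<And>i. i \<in> K \<Longrightarrow> i \<noteq> w \<Longrightarrow> (i, w) \<in> fst L"
        by (rule finite_worst_exists[OF psubset.hyps(1) False oL psubset.prems(1)]) blast
      have wp: "w < p" using w psubset.prems(1) by auto
      note ow = lex_prefD(2)[OF L wp]
      let ?K = "{i. i < p \<and> (i, w) \<in> fst L}"
      have K: "K = insert w ?K"
      proof (intro equalityI subsetI)
        fix i assume "i \<in> K"
        then show "i \<in> insert w ?K" using w(2)[of i] psubset.prems(1) by (cases "i = w") auto
      next
        fix i assume "i \<in> insert w ?K"
        then show "i \<in> K" using w(1) psubset.prems(2)[of w i] by auto
      qed
      have IH: "sum f T = 0" if "saturated n p ?K T" for T
      proof (rule psubset.IH[of ?K])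
        have "w \<notin> ?K" using irr by simp
        then show "?K \<subset> K" using K by blast
        show "i' \<in> ?K" if "i \<in> ?K" "i' < p" "(i', i) \<in> fst L" for i i'
          using that tr by (auto dest: transD)
      qed (use that in auto)
      define E where "E x = {y \<in> bundles n p. \<forall>i\<in>?K. y ! i = x ! i}" for x
      define G where "G x a = {y \<in> E x. y ! w = a \<or> (y ! w, a) \<in> snd L w}" for x a
      have finE: "finite (E x)" for x using finite_bundles by (simp add: E_def)
      have G_nonneg: "0 \<le> sum f (G x a)" if x: "x \<in> bundles n p" and a: "a < n" for x a
      proof -
        define H where "H = {y \<in> bundles n p. \<exists>i\<in>?K. (y ! i, x ! i) \<in> snd L i \<and>
          (\<forall>i'<p. (i', i) \<in> fst L \<longrightarrow> y ! i' = x ! i')}"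
        obtain z where z: "z \<in> bundles n p" "upper_set n p L z = H \<union> G x a"
          using upper_set_prefix[OF L x wp a] unfolding H_def G_def E_def by auto
        \<comment> \<open>Whether a bundle beats \<open>x\<close> above \<open>w\<close> depends
          only on the types above \<open>w\<close>. So \<open>H\<close> has weight 0 by induction,
          and dominance on the upper set becomes an inequality on \<open>G x a\<close>.\<close>
        have "saturated n p ?K H"
          unfolding saturated_def
        proof (intro conjI ballI impI)
          show "H \<subseteq> bundles n p" by (auto simp: H_def)
          fix y y' assume "y \<in> H" and y': "y' \<in> bundles n p" "\<forall>i\<in>?K. y' ! i = y ! i"
          then obtain i where i: "i \<in> ?K" "(y ! i, x ! i) \<in> snd L i"
            "\<And>i'. i' < p \<Longrightarrow> (i', i) \<in> fst L \<Longrightarrow> y ! i' = x ! i'" by (auto simp: H_def)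
          have "y' ! i' = x ! i'" if "i' < p" "(i', i) \<in> fst L" for i'
          proof -
            have "i' \<in> ?K" using that i(1) tr by (auto dest: transD)
            then show ?thesis using i(3)[OF that] y'(2) by auto
          qed
          then show "y' \<in> H" using i(1,2) y' by (auto simp: H_def)
        qed
        then have "sum f H = 0" by (rule IH)
        moreover have "H \<inter> G x a = {}"
          using lex_prefD(2)[OF L]
          by (auto simp: H_def G_def E_def strict_linear_order_on_def irrefl_def)
        moreover have "finite H" "finite (G x a)"
          using finite_bundles finE by (auto simp: H_def G_def)
        moreover have "0 \<le> sum f (upper_set n p L z)"
          using sd z(1) by (auto simp: sd_geq_def f_def sum_subtractf)
        ultimately show ?thesis using z(2) by (simp add: sum.union_disjoint)
      qed
      \<comment> \<open>\<open>T a\<close> is the union of the sets \<open>G x a\<close> over all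
        classes; its weight is a cumulative marginal of type \<open>w\<close>.\<close>
      define T where "T a = {y \<in> bundles n p. y ! w = a \<or> (y ! w, a) \<in> snd L w}" for a
      let ?g = "\<lambda>x i. if i \<in> ?K then x ! i else 0"
      have finT: "finite (T a)" for a using finite_bundles by (simp add: T_def)
      have class_T: "{y. y \<in> T a \<and> ?g y = ?g x} = G x a" for x a
        unfolding class_eq_iff by (auto simp: T_def G_def E_def)
      have T_sum: "sum f (T a) = (\<Sum>c\<in>?g ` T a. \<Sum>y | y \<in> T a \<and> ?g y = c. f y)" for a
        by (rule sum_by_class[OF finT])
      have class_nonneg: "0 \<le> (\<Sum>y | y \<in> T a \<and> ?g y = c. f y)" if "a < n" "c \<in> ?g ` T a" for a c
        using that(2) class_T G_nonneg[OF _ that(1)] by (auto simp: T_def)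
      have T_marg: "sum h (T a) = (\<Sum>b | b < n \<and> (b = a \<or> (b, a) \<in> snd L w). marginal n p h w b)"
        for a and h :: "nat list \<Rightarrow> real"
      proof -
        have "T a = {y. y \<in> bundles n p \<and> y ! w \<in> {b. b < n \<and> (b = a \<or> (b, a) \<in> snd L w)}}"
          using wp by (auto simp: T_def bundles_def)
        then show ?thesis by (subst sum_marginal[OF wp]) auto
      qed
      have T_diff: "sum f (T a) =
          (\<Sum>b | b < n \<and> (b = a \<or> (b, a) \<in> snd L w). marginal n p Q w b) -
          (\<Sum>b | b < n \<and> (b = a \<or> (b, a) \<in> snd L w). marginal n p P w b)" for a
        unfolding T_marg[symmetric] by (simp add: f_def sum_subtractf)
      have T_nonneg: "0 \<le> sum f (T a)" if "a < n" for a
        unfolding T_sum using class_nonneg[OF that] by (rule sum_nonneg)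
      have "marginal n p Q w a = marginal n p P w a" if "a < n" for a
      proof (rule marg[OF wp that])
        fix a assume "a < n"
        from T_nonneg[OF this]
        show "(\<Sum>b | b < n \<and> (b = a \<or> (b, a) \<in> snd L w). marginal n p P w b) \<le>
          (\<Sum>b | b < n \<and> (b = a \<or> (b, a) \<in> snd L w). marginal n p Q w b)"
          unfolding T_diff by simp
      qed
      then have T_zero: "sum f (T a) = 0" for a
        unfolding T_diff by simp
      \<comment> \<open>Nonnegative class sums with total 0 vanish one by one.\<close>
      have G_zero: "sum f (G x a) = 0" if x: "x \<in> bundles n p" and a: "a < n" for x a
      proof (cases "G x a = {}")
        case False
        then obtain y where y: "y \<in> T a" "?g y = ?g x"
          using class_T[of a x] by blast
        have "?g x \<in> ?g ` T a" by (rule image_eqI[where x = y, OF _ y(1)]) (rule y(2)[symmetric])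
        from sum_nonneg_0[OF finite_imageI[OF finT] class_nonneg[OF a] T_zero[unfolded T_sum] this]
        show ?thesis unfolding class_T .
      qed simp
      have class_zero: "(\<Sum>y | y \<in> E x \<and> y ! w = a. f y) = 0"
        if x: "x \<in> bundles n p" and a: "a < n" for x a
      proof (rule sums_better_eq_0_imp_eq_0[OF _ ow])
        fix a assume a: "a \<in> {0..<n}"
        let ?B = "{b \<in> {0..<n}. b = a \<or> (b, a) \<in> snd L w}"
        have "sum f (G x a) = (\<Sum>b\<in>?B. \<Sum>y | y \<in> G x a \<and> y ! w = b. f y)"
        proof (intro sum.group[symmetric])
          show "finite (G x a)" using finE by (simp add: G_def)
        qed (use wp in \<open>auto simp: G_def E_def bundles_def\<close>)
        also have "\<dots> = (\<Sum>b\<in>?B. \<Sum>y | y \<in> E x \<and> y ! w = b. f y)"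
          by (intro sum.cong refl) (auto simp: G_def)
        finally show "(\<Sum>b\<in>?B. \<Sum>y | y \<in> E x \<and> y ! w = b. f y) = 0"
          using G_zero[OF x] a by simp
      qed (use a in auto)
      show ?thesis
      proof (rule saturated_sum_eq_0[OF psubset.prems(3)])
        fix x assume "x \<in> S"
        then have x: "x \<in> bundles n p" using psubset.prems(3) by (auto simp: saturated_def)
        have "{y. y \<in> bundles n p \<and> (\<forall>i\<in>K. y ! i = x ! i)} = {y. y \<in> E x \<and> y ! w = x ! w}"
          by (subst K) (auto simp: E_def)
        then show "(\<Sum>y | y \<in> bundles n p \<and> (\<forall>i\<in>K. y ! i = x ! i). f y) = 0"
          using class_zero[OF x, of "x ! w"] x wp by (simp add: bundles_def)
      qed
    qed
  qed
  moreover have "saturated n p {0..<p} {x}"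
    using \<open>x \<in> bundles n p\<close> by (auto simp: saturated_def bundles_def intro: nth_equalityI)
  ultimately have "sum f {x} = 0" by (meson atLeastLessThan_iff finite_atLeastLessThan le0 subset_refl)
  then show ?thesis by (simp add: f_def)
qed

theorem theorem6:
  fixes n p j :: nat and R :: "nat \<Rightarrow> pref" and L' :: pref
  assumes "\<forall>k<n. lex_pref n p (R k)"
    and "j < n"
    and "lex_pref n p L'"
    and "sd_geq n p (R j) (mps n p (R(j := L')) j) (mps n p R j)"
  shows "\<forall>x\<in>bundles n p. mps n p (R(j := L')) j x = mps n p R j x"
proof (cases "p = 0")
  \<comment> \<open>Without types there are no phases, so both assignments are identically
    0.\<close>
  case True
  then show ?thesis by (simp add: mps_def)
next
  case False
  then have np: "0 < n" "0 < p" using assms(2) by auto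
  let ?R = "R(j := L')"
  have R': "\<forall>k<n. lex_pref n p (?R k)" using assms(1,3) by simp
  obtain \<tau> where \<tau>: "\<And>i a. i < p \<Longrightarrow> a < n \<Longrightarrow> 0 \<le> \<tau> i a \<and> \<tau> i a \<le> 1"
    "\<And>i a. i < p \<Longrightarrow> a < n \<Longrightarrow> (\<Sum>k<n. share {0..<n} (snd (R k) i) (\<tau> i) a) = 1"
    "\<And>k i a. k < n \<Longrightarrow> i < p \<Longrightarrow> a < n \<Longrightarrow>
      marginal n p (mps n p R k) i a = share {0..<n} (snd (R k) i) (\<tau> i) a"
    "\<And>k. k < n \<Longrightarrow> (\<Sum>x\<in>bundles n p. mps n p R k x) = 1"
    using mps_exhaustion_times[OF assms(1) np] by blast
  obtain \<tau>' where \<tau>': "\<And>i a. i < p \<Longrightarrow> a < n \<Longrightarrow> 0 \<le> \<tau>' i a \<and> \<tau>' i a \<le> 1"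
    "\<And>i a. i < p \<Longrightarrow> a < n \<Longrightarrow> (\<Sum>k<n. share {0..<n} (snd (?R k) i) (\<tau>' i) a) = 1"
    "\<And>k i a. k < n \<Longrightarrow> i < p \<Longrightarrow> a < n \<Longrightarrow>
      marginal n p (mps n p ?R k) i a = share {0..<n} (snd (?R k) i) (\<tau>' i) a"
    "\<And>k. k < n \<Longrightarrow> (\<Sum>x\<in>bundles n p. mps n p ?R k x) = 1"
    using mps_exhaustion_times[OF R' np] by blast
  show ?thesis
  proof (intro ballI lex_sd_geq_imp_eq[OF _ assms(4)])
    show "lex_pref n p (R j)" using assms(1,2) by simp
    show "(\<Sum>x\<in>bundles n p. mps n p ?R j x) = (\<Sum>x\<in>bundles n p. mps n p R j x)"
      using \<tau>(4) \<tau>'(4) assms(2) by simp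
    fix i a assume i: "i < p" and a: "a < n" and dom: "\<And>a. a < n \<Longrightarrow>
      (\<Sum>b | b < n \<and> (b = a \<or> (b, a) \<in> snd (R j) i). marginal n p (mps n p R j) i b) \<le>
      (\<Sum>b | b < n \<and> (b = a \<or> (b, a) \<in> snd (R j) i). marginal n p (mps n p ?R j) i b)"
    interpret ps_deviation "{0..<n}" "{..<n}" j "\<lambda>k. snd (R k) i" "\<lambda>k. snd (?R k) i" "\<tau> i" "\<tau>' i"
    proof
      show "strict_linear_order_on {0..<n} (snd (R j) i)"
        "strict_linear_order_on {0..<n} (snd (?R j) i)"
        using assms(1,2) R' lex_prefD(2) i by blast+
    qed (use \<tau> \<tau>' i assms(2) in auto)
    have "share {0..<n} (snd (?R j) i) (\<tau>' i) a = share {0..<n} (snd (R j) i) (\<tau> i) a"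
    proof (rule ps_weak_strategyproof)
      fix a assume "a \<in> {0..<n}"
      then show "(\<Sum>b | b \<in> {0..<n} \<and> (b = a \<or> (b, a) \<in> snd (R j) i).
          share {0..<n} (snd (R j) i) (\<tau> i) b) \<le>
        (\<Sum>b | b \<in> {0..<n} \<and> (b = a \<or> (b, a) \<in> snd (R j) i).
          share {0..<n} (snd (?R j) i) (\<tau>' i) b)"
        using dom[of a] \<tau>(3)[OF assms(2) i] \<tau>'(3)[OF assms(2) i] by simp
    qed (use a in auto)
    then show "marginal n p (mps n p ?R j) i a = marginal n p (mps n p R j) i a"
      using \<tau>(3) \<tau>'(3) assms(2) i a by simp
  qed
qed

end
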